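(* Consider a finite discounted MDP with $\mathcal S_{\mathrm{sep}}\neq\varnothing$ and its Q-value iteration $Q_{k+1}=F(Q_k)$ started from $Q_0\in\mathbb R^n$. Let $\bar\rho$ be the joint spectral radius of $\{\bar A_\pi:\pi\in\Theta\}$ and $\bar\rho_*$ the joint spectral radius of $\bar{\mathcal H}_*:=\{\bar A_\pi:\pi\in\Theta^*\}$. Let $K_{\mathrm{id}}$ be the identification time defined in the context, and put $z_k:=\mathbf\Pi_\perp(Q_k-Q^* )$. Then $\bar\rho_*\le\bar\rho\le\gamma$ and the following hold. 1. For any $\varepsilon>0$ such that $\beta_\varepsilon:=\bar\rho+\varepsilon<1$, there exists a constant $c_\varepsilon>0$ such that $\operatorname{dist}_2(Q_k,\mathcal X_1)\le c_\varepsilon\beta_\varepsilon^k\operatorname{dist}_2(Q_0,\mathcal X_1)$ for all $k\ge0$. In particular, the convergence toward $\mathcal X_1$, and hence toward $\mathcal X^*\supset\mathcal X_1$, admits exponential upper bounds at any rate larger than $\bar\rho$. 2. For all $k\ge K_{\mathrm{id}}$, there exists a policy $\pi_k\in\Theta^*$ such that $Q_{k+1}-Q^*=A_{\pi_k}(Q_k-Q^* )$. 3. For any $\varepsilon_*>0$ such that $\beta_*:=\bar\rho_*+\varepsilon_*<1$, there exists a constant $\tilde C_{\varepsilon_*}>0$ such that $\|z_{K_{\mathrm{id}}+\ell}\|_2\le\tilde C_{\varepsilon_*}\beta_*^\ell\|z_{K_{\mathrm{id}}}\|_2$ for all $\ell\ge0$. 4. If, in addition, $\bar\rho_*<\gamma$,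 then one may choose $\varepsilon_*>0$ sufficiently small that $\beta_*=\bar\rho_*+\varepsilon_*<\gamma$, and in this case there exists a constant $D_{\varepsilon_*}>0$ such that $\|Q_{K_{\mathrm{id}}+\ell}-Q^*\|_2\le D_{\varepsilon_*}\gamma^\ell\|Q_{K_{\mathrm{id}}}-Q^*\|_2$ for all $\ell\ge0$. The constants $c_\varepsilon,\tilde C_{\varepsilon_*},D_{\varepsilon_*}$ depend only on the indicated $\varepsilon$ or $\varepsilon_*$ and on the MDP.
   Context: Finite discounted MDP: finite nonempty state set $\mathcal S$ and action set $\mathcal A$, transition probabilities $P(s'|s,a)$, expected one-step rewards $R(s,a)\in\mathbb R$, discount $\gamma\in(0,1)$. Put $n=|\mathcal S||\mathcal A|$ and identify functions $Q:\mathcal S\times\mathcal A\to\mathbb R$ with vectors in $\mathbb R^n$. $P$ also denotes the $n\times|\mathcal S|$ matrix with entry $P(s'|s,a)$ in row $(s,a)$, column $s'$. For a deterministic policy $\pi:\mathcal S\to\mathcal A$, $\Pi^\pi$ is the $|\mathcal S|\times n$ matrix with $(\Pi^\pi Q)(s)=Q(s,\pi(s))$. $\Theta$ is the (finite) set of all deterministic policies. Bellman operator: $(FQ)(s,a)=R(s,a)+\gamma\sum_{s'}P(s'|s,a)\max_{a'}Q(s',a')$. $Q^*$ is the optimal Q-function, $Q^*(s,a)=\max_{\pi\in\Theta}Q^\pi(s,a)$, the unique fixed point of $F$; $V^*(s)=\max_aQ^*(s,a)$. Q-value iteration: $Q_{k+1}=F(Q_k)$, $k\ge0$. $\pi_Q(s)$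 is the element of $\operatorname{Arg\,max}_aQ(s,a)$ selected by a fixed tie-breaking rule. $\Phi^*(s):=\operatorname{Arg\,max}_{a}Q^*(s,a)$ (a set); $\Theta^*:=\{\pi\in\Theta:\pi(s)\in\Phi^*(s)\ \forall s\}$ is the set of optimal deterministic policies. $\mathcal X^*:=\{Q\in\mathbb R^n:\pi_Q(s)\in\Phi^*(s)\ \forall s\}$. $\mathcal S_{\mathrm{sep}}:=\{s:\Phi^*(s)\ne\mathcal A\}$; for $s\in\mathcal S_{\mathrm{sep}}$, $\bar\Delta_s:=V^*(s)-\max_{a\notin\Phi^*(s)}Q^*(s,a)$; $\bar\Delta:=\min_{s\in\mathcal S_{\mathrm{sep}}}\bar\Delta_s>0$. $\mathbf 1\in\mathbb R^n$ is the all-ones vector, $\mathcal X_1:=Q^*+\operatorname{span}(\mathbf 1)$, $\operatorname{dist}_2$ is Euclidean distance. $\mathbf\Pi_\perp:=I-\frac1n\mathbf 1\mathbf 1^\top$, $A_\pi:=\gamma P\Pi^\pi$, $\bar A_\pi:=\mathbf\Pi_\perp A_\pi\mathbf\Pi_\perp$. Joint spectral radius of a finite set of matrices: $\rho(M_1,\dots,M_m)=\lim_{k\to\infty}\max_{\sigma\in\{1,\dots,m\}^k}\|M_{\sigma_k}\cdots M_{\sigma_1}\|^{1/k}$ (any submultiplicative norm). Identification time $K_{\mathrm{id}}$: fix some $\varepsilon_0>0$ with $\beta_0:=\bar\rho+\varepsilon_0\in(0,1)$ and a constant $c_0>0$ such that every Q-value iteration trajectory satisfies $\operatorname{dist}_2(Q_k,\mathcal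 X_1)\le c_0\beta_0^k\operatorname{dist}_2(Q_0,\mathcal X_1)$ for all $k\ge0$. Then $K_{\mathrm{id}}:=0$ if $c_0\operatorname{dist}_2(Q_0,\mathcal X_1)<\bar\Delta/2$, and otherwise $K_{\mathrm{id}}:=\left\lfloor\frac{\log(2c_0\operatorname{dist}_2(Q_0,\mathcal X_1)/\bar\Delta)}{-\log\beta_0}\right\rfloor+1$. *)

theory Defs
  imports "HOL-Analysis.Analysis"
begin

section \<open>Joint spectral radius\<close>

text \<open>The limit does not depend on the submultiplicative norm; we fix the operator norm induced by
  the Euclidean norm. Words \<open>\<sigma>\<close> of length \<open>k\<close> are lists of matrices.\<close>

definition jsr :: "(real^'n^'n) set \<Rightarrow> real" where
  "jsr \<M> = lim (\<lambda>k. MAX xs \<in> {xs. set xs \<subseteq> \<M> \<and> length xs = k}.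
                     root k (onorm ((*v) (foldr (**) xs (mat 1)))))"

section \<open>Finite discounted MDPs\<close>

text \<open>The state set and the action set are the universes of the finite types \<open>'s\<close> and \<open>'a\<close>;
  Q-functions are vectors indexed by state-action pairs. A deterministic policy is a function
  \<open>'s \<Rightarrow> 'a\<close>, and \<open>\<Theta>\<close> is the set of all of them.\<close>

record ('s, 'a) mdp =
  trans :: "'s \<Rightarrow> 'a \<Rightarrow> 's \<Rightarrow> real"  \<comment> \<open>\<open>trans M s a s'\<close> is \<open>P(s' | s, a)\<close>\<close>
  rew :: "'s \<Rightarrow> 'a \<Rightarrow> real"
  disc :: real

definition is_mdp :: "('s::finite, 'a::finite) mdp \<Rightarrow> bool" where
  "is_mdp M \<longleftrightarrow> (\<forall>s a s'. 0 \<le> trans M s a s') \<and> (\<forall>s a. (\<Sum>s'\<in>UNIV. trans M s a s') = 1) \<and>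
     0 < disc M \<and> disc M < 1"

definition trans_mat :: "('s::finite, 'a::finite) mdp \<Rightarrow> real^'s^('s \<times> 'a)" where
  "trans_mat M = (\<chi> sa s'. trans M (fst sa) (snd sa) s')"

definition rew_vec :: "('s::finite, 'a::finite) mdp \<Rightarrow> real^('s \<times> 'a)" where
  "rew_vec M = (\<chi> sa. rew M (fst sa) (snd sa))"

text \<open>\<open>(pol_mat \<pi> *v Q) $ s = Q $ (s, \<pi> s)\<close>\<close>

definition pol_mat :: "('s::finite \<Rightarrow> 'a::finite) \<Rightarrow> real^('s \<times> 'a)^'s" where
  "pol_mat \<pi> = (\<chi> s sa. if sa = (s, \<pi> s) then 1 else 0)"

definition bellman ::
    "('s::finite, 'a::finite) mdp \<Rightarrow> real^('s \<times> 'a) \<Rightarrow> real^('s \<times> 'a)" where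
  "bellman M Q = (\<chi> sa. rew M (fst sa) (snd sa) +
     disc M * (\<Sum>s'\<in>UNIV. trans M (fst sa) (snd sa) s' * (MAX a'. Q $ (s', a'))))"

definition Qiter ::
    "('s::finite, 'a::finite) mdp \<Rightarrow> real^('s \<times> 'a) \<Rightarrow> nat \<Rightarrow> real^('s \<times> 'a)" where
  "Qiter M Q0 k = (bellman M ^^ k) Q0"

text \<open>Expected discounted return: starting from \<open>(s, a)\<close> and following \<open>\<pi>\<close> afterwards, the
  distribution of the state-action pair at time \<open>t\<close> is row \<open>(s, a)\<close> of the \<open>t\<close>-th power of
  \<open>trans_mat M ** pol_mat \<pi>\<close>.\<close>

definition Qpol :: "('s::finite, 'a::finite) mdp \<Rightarrow> ('s \<Rightarrow> 'a) \<Rightarrow> real^('s \<times> 'a)" where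
  "Qpol M \<pi> = (\<Sum>t. disc M ^ t *\<^sub>R ((*v) (trans_mat M ** pol_mat \<pi>) ^^ t) (rew_vec M))"

definition Qstar :: "('s::finite, 'a::finite) mdp \<Rightarrow> real^('s \<times> 'a)" where
  "Qstar M = (\<chi> sa. MAX \<pi>. Qpol M \<pi> $ sa)"

definition Vstar :: "('s::finite, 'a::finite) mdp \<Rightarrow> 's \<Rightarrow> real" where
  "Vstar M s = (MAX a. Qstar M $ (s, a))"

section \<open>Greedy policies and the action gap\<close>

definition Argmax :: "real^('s::finite \<times> 'a::finite) \<Rightarrow> 's \<Rightarrow> 'a set" where
  "Argmax Q s = {a. is_arg_max (\<lambda>a. Q $ (s, a)) (\<lambda>_. True) a}"

definition Phistar :: "('s::finite, 'a::finite) mdp \<Rightarrow> 's \<Rightarrow> 'a set" where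
  "Phistar M = Argmax (Qstar M)"

definition Thetastar :: "('s::finite, 'a::finite) mdp \<Rightarrow> ('s \<Rightarrow> 'a) set" where
  "Thetastar M = {\<pi>. \<forall>s. \<pi> s \<in> Phistar M s}"

text \<open>A tie-breaking rule selects, in each state, an element of every nonempty set of actions.\<close>

definition tie_breaking :: "('s \<Rightarrow> 'a set \<Rightarrow> 'a) \<Rightarrow> bool" where
  "tie_breaking tb \<longleftrightarrow> (\<forall>s B. B \<noteq> {} \<longrightarrow> tb s B \<in> B)"

definition greedy ::
    "('s::finite \<Rightarrow> 'a::finite set \<Rightarrow> 'a) \<Rightarrow> real^('s \<times> 'a) \<Rightarrow> 's \<Rightarrow> 'a" where
  "greedy tb Q s = tb s (Argmax Q s)"

definition Xstar ::
    "('s::finite, 'a::finite) mdp \<Rightarrow> ('s \<Rightarrow> 'a set \<Rightarrow> 'a) \<Rightarrow> (real^('s \<times> 'a)) set" where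
  "Xstar M tb = {Q. \<forall>s. greedy tb Q s \<in> Phistar M s}"

definition X1 :: "('s::finite, 'a::finite) mdp \<Rightarrow> (real^('s \<times> 'a)) set" where
  "X1 M = (+) (Qstar M) ` span {1}"

definition Ssep :: "('s::finite, 'a::finite) mdp \<Rightarrow> 's set" where
  "Ssep M = {s. Phistar M s \<noteq> UNIV}"

definition gap_at :: "('s::finite, 'a::finite) mdp \<Rightarrow> 's \<Rightarrow> real" where
  "gap_at M s = Vstar M s - (MAX a \<in> - Phistar M s. Qstar M $ (s, a))"

definition gap :: "('s::finite, 'a::finite) mdp \<Rightarrow> real" where
  "gap M = (MIN s \<in> Ssep M. gap_at M s)"

section \<open>Projected switching matrices\<close>

definition proj_perp :: "real^'n^'n" where
  "proj_perp = mat 1 - (1 / real CARD('n)) *\<^sub>R (\<chi> i j. 1)"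

definition A_mat ::
    "('s::finite, 'a::finite) mdp \<Rightarrow> ('s \<Rightarrow> 'a) \<Rightarrow> real^('s \<times> 'a)^('s \<times> 'a)" where
  "A_mat M \<pi> = disc M *\<^sub>R (trans_mat M ** pol_mat \<pi>)"

definition Abar_mat ::
    "('s::finite, 'a::finite) mdp \<Rightarrow> ('s \<Rightarrow> 'a) \<Rightarrow> real^('s \<times> 'a)^('s \<times> 'a)" where
  "Abar_mat M \<pi> = proj_perp ** A_mat M \<pi> ** proj_perp"

definition rho_bar :: "('s::finite, 'a::finite) mdp \<Rightarrow> real" where
  "rho_bar M = jsr (range (Abar_mat M))"

definition rho_star :: "('s::finite, 'a::finite) mdp \<Rightarrow> real" where
  "rho_star M = jsr (Abar_mat M ` Thetastar M)"

definition zvec ::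
    "('s::finite, 'a::finite) mdp \<Rightarrow> real^('s \<times> 'a) \<Rightarrow> nat \<Rightarrow> real^('s \<times> 'a)" where
  "zvec M Q0 k = proj_perp *v (Qiter M Q0 k - Qstar M)"

section \<open>Identification time\<close>

text \<open>The admissible choices of the constants \<open>\<epsilon>\<^sub>0\<close> and \<open>c\<^sub>0\<close> on which the identification time depends.\<close>

definition id_consts :: "('s::finite, 'a::finite) mdp \<Rightarrow> real \<Rightarrow> real \<Rightarrow> bool" where
  "id_consts M \<epsilon>0 c0 \<longleftrightarrow> 0 < \<epsilon>0 \<and> 0 < rho_bar M + \<epsilon>0 \<and> rho_bar M + \<epsilon>0 < 1 \<and> 0 < c0 \<and>
     (\<forall>Q0 k. infdist (Qiter M Q0 k) (X1 M) \<le> c0 * (rho_bar M + \<epsilon>0) ^ k * infdist Q0 (X1 M))"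

text \<open>In the second case the logarithm is nonnegative whenever \<open>gap M > 0\<close>, so \<open>nat\<close> does not
  truncate.\<close>

definition K_id ::
    "('s::finite, 'a::finite) mdp \<Rightarrow> real \<Rightarrow> real \<Rightarrow> real^('s \<times> 'a) \<Rightarrow> nat" where
  "K_id M \<epsilon>0 c0 Q0 =
     (if c0 * infdist Q0 (X1 M) < gap M / 2 then 0
      else nat \<lfloor>ln (2 * c0 * infdist Q0 (X1 M) / gap M) / (- ln (rho_bar M + \<epsilon>0))\<rfloor> + 1)"

end

theory Submission
  imports Defs
begin

text \<open>The difference \<open>bellman M Q - Qstar M\<close> is a convex combination of the vectors
  \<open>A_mat M \<pi> *v (Q - Qstar M)\<close>, because in each state the difference of the two maxima lies between two
  entries of \<open>Q - Qstar M\<close>. Since every \<open>A_mat M \<pi>\<close> maps constant vectors to constant vectors, this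
  descends to the projections. For \<open>\<beta> > rho_bar M\<close> there is a norm in which every \<open>Abar_mat M \<pi>\<close> is
  Lipschitz with constant \<open>\<beta>\<close>; convex combinations inherit this. Once the distance to \<open>X1 M\<close> is below
  half the action gap, greedy actions are optimal, so a single policy in \<open>Thetastar M\<close> realizes the
  step exactly. The rate \<open>disc M\<close> in part 4 is the contraction of the Bellman operator in the
  maximum norm.\<close>

section \<open>Joint spectral radius\<close>

lemma submult_power_bound:
  fixes m :: "nat \<Rightarrow> real"
  assumes nonneg: "\<And>k. 0 \<le> m k" and submult: "\<And>i j. m (i + j) \<le> m i * m j"
    and p: "0 < p" "m p \<le> \<beta> ^ p" and \<beta>: "0 < \<beta>"
  shows "\<exists>C>0. \<forall>k. m k \<le> C * \<beta> ^ k"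
proof -
  \<comment> \<open>\<open>C\<close> absorbs the finitely many remainders \<open>r < p\<close>; the
    summand 1 keeps it positive when every \<open>m r\<close> vanishes.\<close>
  define C where "C = 1 + (\<Sum>r<p. m r / \<beta> ^ r)"
  have Cge: "m r \<le> C * \<beta> ^ r" if "r < p" for r
  proof -
    have "m r / \<beta> ^ r \<le> (\<Sum>r<p. m r / \<beta> ^ r)"
      using that nonneg \<beta> by (intro member_le_sum) auto
    then have "m r / \<beta> ^ r \<le> C" by (simp add: C_def)
    then show ?thesis using \<beta> by (simp add: pos_divide_le_eq)
  qed
  \<comment> \<open>Division of \<open>k\<close> by \<open>p\<close>: each of the \<open>q\<close>
    full blocks costs \<open>m p\<close>, hence at most \<open>\<beta> ^ p\<close>.\<close>
  have step: "m (q * p + r) \<le> (\<beta> ^ p) ^ q * m r" for q r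
  proof (induction q)
    case (Suc q)
    have "m (Suc q * p + r) \<le> m p * m (q * p + r)"
      using submult[of p "q * p + r"] by (simp add: add.assoc)
    also have "\<dots> \<le> \<beta> ^ p * ((\<beta> ^ p) ^ q * m r)"
      using p \<beta> nonneg Suc by (intro mult_mono) auto
    finally show ?case by (simp add: mult.assoc)
  qed simp
  have "m k \<le> C * \<beta> ^ k" for k
  proof -
    have "m k \<le> (\<beta> ^ p) ^ (k div p) * m (k mod p)"
      using step[of "k div p" "k mod p"] by simp
    also have "\<dots> \<le> (\<beta> ^ p) ^ (k div p) * (C * \<beta> ^ (k mod p))"
      using Cge[of "k mod p"] p \<beta> by (intro mult_left_mono) auto
    also have "\<dots> = C * \<beta> ^ (p * (k div p) + k mod p)"
      by (simp only: power_mult power_add mult.assoc mult.left_commute)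
    finally show ?thesis by simp
  qed
  moreover have "C > 0"
    unfolding C_def using nonneg \<beta> by (intro add_pos_nonneg sum_nonneg) auto
  ultimately show ?thesis by blast
qed

lemma root_power_bound:
  assumes "0 < k" "0 \<le> x" "x \<le> C * \<beta> ^ k" "0 < C" "0 < \<beta>"
  shows "root k x \<le> root k C * \<beta>"
proof -
  have "root k x \<le> root k (C * \<beta> ^ k)" using assms by (intro real_root_le_mono) auto
  also have "\<dots> = root k C * \<beta>" using assms by (simp add: real_root_mult real_root_power_cancel)
  finally show ?thesis .
qed

text \<open>Fekete's lemma in multiplicative form: the limit is the infimum. For any \<beta> above
  the infimum one index \<open>p\<close> has \<open>m p \<le> \<beta> ^ p\<close>, which gives
  \<open>m k \<le> C * \<beta> ^ k\<close> for all \<open>k\<close>, and \<open>root k C\<close>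
  tends to 1.\<close>

lemma submult_root_convergent:
  fixes m :: "nat \<Rightarrow> real"
  assumes nonneg: "\<And>k. 0 \<le> m k" and submult: "\<And>i j. m (i + j) \<le> m i * m j"
  shows "convergent (\<lambda>k. root k (m k))"
proof -
  \<comment> \<open>Index 0 is excluded because \<open>root 0\<close> is constantly 0.\<close>
  define L where "L = (INF k\<in>{1..}. root k (m k))"
  have bdd: "bdd_below ((\<lambda>k. root k (m k)) ` {1..})"
    using nonneg by (intro bdd_belowI[of _ 0]) auto
  have Lle: "L \<le> root k (m k)" if "k \<ge> 1" for k
    unfolding L_def using bdd that by (intro cINF_lower) auto
  have L0: "0 \<le> L"
    unfolding L_def using nonneg by (intro cINF_greatest) auto
  have "(\<lambda>k. root k (m k)) \<longlonglongrightarrow> L"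
  proof (rule order_tendstoI)
    fix a assume a: "a < L"
    show "\<forall>\<^sub>F k in sequentially. a < root k (m k)"
      using eventually_ge_at_top[of "1::nat"] by eventually_elim (use Lle a in force)
  next
    fix a assume a: "L < a"
    define \<beta> where "\<beta> = (L + a) / 2"
    have \<beta>: "L < \<beta>" "\<beta> < a" "0 < \<beta>" using a L0 by (auto simp: \<beta>_def)
    obtain p where p: "p \<ge> 1" "root p (m p) < \<beta>"
      using \<beta>(1) cINF_less_iff[OF _ bdd, of \<beta>] unfolding L_def by auto
    have "root p (m p) ^ p \<le> \<beta> ^ p"
      using p nonneg by (intro power_mono) auto
    then have "m p \<le> \<beta> ^ p" using p nonneg by simp
    then obtain C where C: "C > 0" "\<And>k. m k \<le> C * \<beta> ^ k"
      using submult_power_bound[OF nonneg submult, of p \<beta>] p \<beta> by auto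
    have "(\<lambda>k. root k C * \<beta>) \<longlonglongrightarrow> 1 * \<beta>"
      by (intro tendsto_intros LIMSEQ_root_const C)
    then have "\<forall>\<^sub>F k in sequentially. root k C * \<beta> < a"
      using \<beta> by (intro order_tendstoD(2)) auto
    then show "\<forall>\<^sub>F k in sequentially. root k (m k) < a"
      using eventually_ge_at_top[of "1::nat"]
    proof eventually_elim
      case (elim k)
      then show ?case using root_power_bound[of k "m k" C \<beta>] C nonneg \<beta> by force
    qed
  qed
  then show ?thesis by (auto simp: convergent_def)
qed

section \<open>Norms of matrix products and the joint spectral radius\<close>

abbreviation word_prod :: "(real^'n^'n) list \<Rightarrow> real^'n^'n" where
  "word_prod xs \<equiv> foldr (**) xs (mat 1)"

lemma word_prod_append: "word_prod (xs @ ys) = word_prod xs ** word_prod ys"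
  by (induction xs) (auto simp: matrix_mul_assoc)

definition words :: "'b set \<Rightarrow> nat \<Rightarrow> 'b list set" where
  "words \<M> k = {xs. set xs \<subseteq> \<M> \<and> length xs = k}"

lemma finite_words: "finite \<M> \<Longrightarrow> finite (words \<M> k)"
  unfolding words_def by (rule finite_lists_length_eq)

lemma words_nonempty: "\<M> \<noteq> {} \<Longrightarrow> words \<M> k \<noteq> {}"
proof -
  assume "\<M> \<noteq> {}"
  then obtain A where "A \<in> \<M>" by blast
  then have "replicate k A \<in> words \<M> k" by (auto simp: words_def)
  then show ?thesis by blast
qed

text \<open>The root in \<open>jsr\<close> is left out here so that the sequence is
  submultiplicative.\<close>

definition max_word_norm :: "(real^'n^'n) set \<Rightarrow> nat \<Rightarrow> real" where
  "max_word_norm \<M> k = (MAX xs\<in>words \<M> k. onorm ((*v) (word_prod xs)))"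

lemma onorm_word_le_max:
  assumes "finite \<M>" "set xs \<subseteq> \<M>"
  shows "onorm ((*v) (word_prod xs)) \<le> max_word_norm \<M> (length xs)"
  unfolding max_word_norm_def using assms
  by (intro Max_ge finite_imageI finite_words) (auto simp: words_def)

lemma max_word_norm_le:
  assumes "finite \<M>" "\<M> \<noteq> {}"
    and "\<And>xs. set xs \<subseteq> \<M> \<Longrightarrow> length xs = k \<Longrightarrow> onorm ((*v) (word_prod xs)) \<le> B"
  shows "max_word_norm \<M> k \<le> B"
  unfolding max_word_norm_def using assms finite_words[OF assms(1)] words_nonempty[OF assms(2)]
  by (intro Max.boundedI) (auto simp: words_def)

lemma max_word_norm_nonneg:
  assumes "finite \<M>" "\<M> \<noteq> {}"
  shows "0 \<le> max_word_norm \<M> k"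
proof -
  obtain xs where xs: "xs \<in> words \<M> k" using words_nonempty[OF assms(2)] by blast
  then show ?thesis
    using onorm_word_le_max[OF assms(1), of xs] onorm_pos_le[OF matrix_vector_mul_bounded_linear, of "word_prod xs"]
    by (auto simp: words_def)
qed

lemma max_word_norm_submult:
  assumes "finite \<M>" "\<M> \<noteq> {}"
  shows "max_word_norm \<M> (i + j) \<le> max_word_norm \<M> i * max_word_norm \<M> j"
proof (rule max_word_norm_le[OF assms])
  fix zs assume zs: "set zs \<subseteq> \<M>" "length zs = i + j"
  define xs ys where "xs = take i zs" and "ys = drop i zs"
  have s: "zs = xs @ ys" "length xs = i" "length ys = j" "set xs \<subseteq> \<M>" "set ys \<subseteq> \<M>"
    using zs set_take_subset[of i zs] set_drop_subset[of i zs] by (auto simp: xs_def ys_def)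
  have "(*v) (word_prod zs) = (*v) (word_prod xs) \<circ> (*v) (word_prod ys)"
    unfolding s(1) word_prod_append by (auto simp: matrix_vector_mul_assoc)
  then have "onorm ((*v) (word_prod zs)) \<le> onorm ((*v) (word_prod xs)) * onorm ((*v) (word_prod ys))"
    by (simp add: onorm_compose matrix_vector_mul_bounded_linear)
  also have "\<dots> \<le> max_word_norm \<M> i * max_word_norm \<M> j"
    using onorm_word_le_max[OF assms(1) s(4)] onorm_word_le_max[OF assms(1) s(5)] s(2,3)
    by (intro mult_mono max_word_norm_nonneg[OF assms] onorm_pos_le matrix_vector_mul_bounded_linear) auto
  finally show "onorm ((*v) (word_prod zs)) \<le> \<dots>" .
qed

text \<open>Monotonicity moves the root out of the maximum, and Fekete's lemma supplies the
  convergence that gives meaning to \<open>lim\<close> in \<open>jsr\<close>.\<close>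

lemma jsr_LIMSEQ:
  assumes "finite \<M>" "\<M> \<noteq> {}"
  shows "(\<lambda>k. root k (max_word_norm \<M> k)) \<longlonglongrightarrow> jsr \<M>"
proof -
  have "(MAX xs\<in>words \<M> k. root k (onorm ((*v) (word_prod xs)))) = root k (max_word_norm \<M> k)" for k
  proof -
    have "mono (root k)"
      by (rule monoI, cases "k = 0") (auto intro: real_root_le_mono)
    then show ?thesis unfolding max_word_norm_def
      by (subst mono_Max_commute) (auto simp: finite_words words_nonempty assms image_image)
  qed
  then have "jsr \<M> = lim (\<lambda>k. root k (max_word_norm \<M> k))"
    unfolding jsr_def by (simp add: words_def)
  then show ?thesis
    using submult_root_convergent[OF max_word_norm_nonneg[OF assms] max_word_norm_submult[OF assms]]
    by (simp add: convergent_LIMSEQ_iff)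
qed

lemma jsr_nonneg:
  assumes "finite \<M>" "\<M> \<noteq> {}"
  shows "0 \<le> jsr \<M>"
  using jsr_LIMSEQ[OF assms] max_word_norm_nonneg[OF assms]
  by (intro LIMSEQ_le_const[of _ "jsr \<M>"]) (auto intro!: exI[of _ 1])

lemma jsr_mono:
  assumes "finite \<N>" "\<M> \<noteq> {}" "\<M> \<subseteq> \<N>"
  shows "jsr \<M> \<le> jsr \<N>"
proof -
  have fin: "finite \<M>" "\<N> \<noteq> {}" using assms finite_subset by auto
  have "max_word_norm \<M> k \<le> max_word_norm \<N> k" for k
    using onorm_word_le_max[OF assms(1)] assms(3)
    by (intro max_word_norm_le[OF fin(1) assms(2)]) force
  then have "root k (max_word_norm \<M> k) \<le> root k (max_word_norm \<N> k)" for k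
    by (cases "k = 0") auto
  then show ?thesis
    using LIMSEQ_le[OF jsr_LIMSEQ[OF fin(1) assms(2)] jsr_LIMSEQ[OF assms(1) fin(2)]] by auto
qed

text \<open>The constant \<open>C\<close> is harmless since its \<open>k\<close>-th root tends to
  1.\<close>

lemma jsr_le:
  assumes "finite \<M>" "\<M> \<noteq> {}" "0 < C" "0 < \<beta>"
    and bound: "\<And>xs. set xs \<subseteq> \<M> \<Longrightarrow> onorm ((*v) (word_prod xs)) \<le> C * \<beta> ^ length xs"
  shows "jsr \<M> \<le> \<beta>"
proof -
  have "root k (max_word_norm \<M> k) \<le> root k C * \<beta>" if "k \<ge> 1" for k
    using that assms max_word_norm_nonneg[OF assms(1,2), of k] max_word_norm_le[OF assms(1,2), of k "C * \<beta> ^ k"]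
    by (intro root_power_bound) auto
  moreover have "(\<lambda>k. root k C * \<beta>) \<longlonglongrightarrow> 1 * \<beta>"
    by (intro tendsto_intros LIMSEQ_root_const assms)
  ultimately show ?thesis
    using LIMSEQ_le[OF jsr_LIMSEQ[OF assms(1,2)], of "\<lambda>k. root k C * \<beta>" \<beta>] by auto
qed

text \<open>A single length \<open>p \<ge> 1\<close> at which the root drops below \<beta> controls
  words of all lengths through \<open>submult_power_bound\<close>.\<close>

lemma jsr_word_bound:
  assumes "finite \<M>" "\<M> \<noteq> {}" "jsr \<M> < \<beta>"
  shows "\<exists>C>0. \<forall>xs. set xs \<subseteq> \<M> \<longrightarrow> onorm ((*v) (word_prod xs)) \<le> C * \<beta> ^ length xs"
proof -
  have \<beta>: "0 < \<beta>" using jsr_nonneg[OF assms(1,2)] assms(3) by simp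
  have "\<forall>\<^sub>F k in sequentially. root k (max_word_norm \<M> k) < \<beta>"
    by (rule order_tendstoD(2)[OF jsr_LIMSEQ[OF assms(1,2)] assms(3)])
  then have "\<forall>\<^sub>F k in sequentially. root k (max_word_norm \<M> k) < \<beta> \<and> k \<ge> 1"
    using eventually_ge_at_top eventually_conj by blast
  then obtain p where p: "root p (max_word_norm \<M> p) < \<beta>" "p \<ge> 1"
    using eventually_happens' sequentially_bot by blast
  have "root p (max_word_norm \<M> p) ^ p \<le> \<beta> ^ p"
    using p max_word_norm_nonneg[OF assms(1,2)] by (intro power_mono) auto
  then have "max_word_norm \<M> p \<le> \<beta> ^ p" using p max_word_norm_nonneg[OF assms(1,2)] by simp
  then obtain C where "C > 0" "\<And>k. max_word_norm \<M> k \<le> C * \<beta> ^ k"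
    using submult_power_bound[where m = "max_word_norm \<M>" and p = p and \<beta> = \<beta>]
      max_word_norm_nonneg[OF assms(1,2)] max_word_norm_submult[OF assms(1,2)] p \<beta>
    by auto
  then show ?thesis using onorm_word_le_max[OF assms(1)] order_trans by blast
qed

text \<open>The sets of all \<open>y\<close> with \<open>\<parallel>word_prod xs *v y\<parallel> \<le> r \<beta>\<^bsup>length xs\<^esup>\<close> for every word are the balls of an
  extremal norm. Each matrix maps the ball of radius \<open>r\<close> into that of radius \<open>\<beta> r\<close>, and so does
  every convex combination, since balls are convex.\<close>

lemma switched_system_bound:
  fixes \<M> :: "(real^'n^'n) set"
  assumes "finite \<M>" "\<M> \<noteq> {}" "jsr \<M> < \<beta>"
  shows "\<exists>C>0. \<forall>z. (\<forall>k. z (Suc k) \<in> convex hull ((\<lambda>A. A *v z k) ` \<M>)) \<longrightarrow>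
    (\<forall>k. norm (z k) \<le> C * \<beta> ^ k * norm (z 0))"
proof -
  obtain C where C: "C > 0"
    "\<And>xs. set xs \<subseteq> \<M> \<Longrightarrow> onorm ((*v) (word_prod xs)) \<le> C * \<beta> ^ length xs"
    using jsr_word_bound[OF assms] by blast
  define B where "B r = (\<Inter>xs\<in>{xs. set xs \<subseteq> \<M>}. (*v) (word_prod xs) -` cball 0 (r * \<beta> ^ length xs))" for r
  have convex_B: "convex (B r)" for r
    unfolding B_def by (intro convex_INT convex_linear_vimage) auto
  have B_iff: "y \<in> B r \<longleftrightarrow> (\<forall>xs. set xs \<subseteq> \<M> \<longrightarrow> norm (word_prod xs *v y) \<le> r * \<beta> ^ length xs)" for y r
    by (auto simp: B_def)
  have step: "A *v y \<in> B (r * \<beta>)" if "A \<in> \<M>" "y \<in> B r" for A y r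
    unfolding B_iff
  proof (intro allI impI)
    fix xs assume "set xs \<subseteq> \<M>"
    \<comment> \<open>Testing \<open>A *v y\<close> with the word \<open>xs\<close> is testing
      \<open>y\<close> with \<open>xs @ [A]\<close>; the extra letter accounts for the extra factor
      \<beta>.\<close>
    then have "norm (word_prod (xs @ [A]) *v y) \<le> r * \<beta> ^ length (xs @ [A])"
      using that unfolding B_iff by (metis empty_set insert_subset list.simps(15) set_append sup.bounded_iff empty_subsetI)
    then show "norm (word_prod xs *v (A *v y)) \<le> r * \<beta> * \<beta> ^ length xs"
      by (simp only: word_prod_append) (simp add: matrix_vector_mul_assoc mult.assoc)
  qed
  have "norm (z k) \<le> C * \<beta> ^ k * norm (z 0)"
    if z: "\<And>k. z (Suc k) \<in> convex hull ((\<lambda>A. A *v z k) ` \<M>)" for z :: "nat \<Rightarrow> real^'n" and k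
  proof -
    have "z k \<in> B (C * norm (z 0) * \<beta> ^ k)"
    proof (induction k)
      case 0
      have "norm (word_prod xs *v z 0) \<le> C * norm (z 0) * \<beta> ^ length xs" if "set xs \<subseteq> \<M>" for xs
      proof -
        have "norm (word_prod xs *v z 0) \<le> onorm ((*v) (word_prod xs)) * norm (z 0)"
          by (intro onorm matrix_vector_mul_bounded_linear)
        also have "\<dots> \<le> C * \<beta> ^ length xs * norm (z 0)"
          by (intro mult_right_mono C that) auto
        finally show ?thesis by (simp add: mult_ac)
      qed
      then show ?case by (simp add: B_iff)
    next
      case (Suc k)
      have "convex hull ((\<lambda>A. A *v z k) ` \<M>) \<subseteq> B (C * norm (z 0) * \<beta> ^ k * \<beta>)"
        using step[OF _ Suc] by (intro hull_minimal convex_B) auto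
      then show ?case using z[of k] by (auto simp: mult_ac)
    qed
    \<comment> \<open>The empty word turns membership in the ball into a bound on the Euclidean
      norm.\<close>
    then have "norm (word_prod [] *v z k) \<le> C * norm (z 0) * \<beta> ^ k * \<beta> ^ length []"
      unfolding B_iff by (drule_tac spec[of _ "[]"]) simp
    then show ?thesis by (simp add: mult_ac)
  qed
  then show ?thesis using C(1) by blast
qed

section \<open>Optimality and switching form of the Bellman operator\<close>

lemma finite_type_max:
  fixes f :: "'b::finite \<Rightarrow> real"
  obtains x where "f x = (MAX y. f y)" "\<And>y. f y \<le> f x"
proof -
  have "Max (range f) \<in> range f" by (intro Max_in) auto
  then obtain x where x: "f x = Max (range f)" by force
  show ?thesis by (rule that[OF x]) (simp add: x)
qed

lemma infnorm_cart_le: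
  fixes x :: "real^'n"
  assumes "\<And>i. \<bar>x $ i\<bar> \<le> B"
  shows "infnorm x \<le> B"
  unfolding infnorm_cart using assms by (intro cSup_least) auto

text \<open>This is the factor \<gamma>P common to \<open>bellman M\<close> and to every
  \<open>A_mat M \<pi>\<close>; they differ only in how a Q-function is reduced to one value per
  state.\<close>

definition lift_trans :: "('s::finite, 'a::finite) mdp \<Rightarrow> real^'s \<Rightarrow> real^('s \<times> 'a)" where
  "lift_trans M v = disc M *\<^sub>R (trans_mat M *v v)"

definition state_max :: "real^('s::finite \<times> 'a::finite) \<Rightarrow> real^'s" where
  "state_max Q = (\<chi> s. MAX a. Q $ (s, a))"

lemma state_max_ge: "Q $ (s, a) \<le> state_max Q $ s"
  by (simp add: state_max_def)

lemma state_max_attained: obtains a where "state_max Q $ s = Q $ (s, a)"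
  using finite_type_max[of "\<lambda>a. Q $ (s, a)"] by (metis state_max_def vec_lambda_beta)

lemma pol_mat_nth: "(pol_mat \<pi> *v Q) $ s = Q $ (s, \<pi> s)"
  by (simp add: pol_mat_def matrix_vector_mult_def if_distrib[of "\<lambda>x. x * _"] cong: if_cong)

lemma state_max_policy: obtains \<pi> where "state_max Q = pol_mat \<pi> *v Q"
proof -
  have "\<forall>s. \<exists>a. state_max Q $ s = Q $ (s, a)" using state_max_attained by metis
  then obtain \<pi> where "\<forall>s. state_max Q $ s = Q $ (s, \<pi> s)" by metis
  then show ?thesis by (intro that[of \<pi>]) (simp add: vec_eq_iff pol_mat_nth)
qed

lemma A_mat_mult: "A_mat M \<pi> *v Q = lift_trans M (pol_mat \<pi> *v Q)"
  by (simp add: A_mat_def lift_trans_def scaleR_matrix_vector_assoc[symmetric] matrix_vector_mul_assoc)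

lemma lift_trans_nth:
  "lift_trans M v $ sa = disc M * (\<Sum>s'\<in>UNIV. trans M (fst sa) (snd sa) s' * v $ s')"
  by (simp add: lift_trans_def trans_mat_def matrix_vector_mult_def)

lemma bellman_eq: "bellman M Q = rew_vec M + lift_trans M (state_max Q)"
  by (simp add: vec_eq_iff bellman_def rew_vec_def lift_trans_nth state_max_def)

lemma linear_lift_trans: "linear (lift_trans M)"
  unfolding lift_trans_def by (intro linear_compose_scale_right matrix_vector_mul_linear)

lemmas lift_trans_diff = linear_diff[OF linear_lift_trans]

section \<open>Discounting, policy values and the optimality equation\<close>

context
  fixes M :: "('s::finite, 'a::finite) mdp"
  assumes mdp: "is_mdp M"
begin

lemma disc_bounds: "0 < disc M" "disc M < 1"
  using mdp by (auto simp: is_mdp_def)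

text \<open>The transition probabilities of each pair sum to 1. Hence the direction of constant
  vectors is invariant and can be projected out.\<close>

lemma lift_trans_const: "lift_trans M (c *\<^sub>R 1) = (disc M * c) *\<^sub>R 1"
  using mdp by (simp add: vec_eq_iff lift_trans_nth is_mdp_def sum_distrib_right[symmetric])

lemma lift_trans_mono:
  assumes "\<And>s. v $ s \<le> w $ s"
  shows "lift_trans M v $ sa \<le> lift_trans M w $ sa"
  using mdp assms unfolding lift_trans_nth is_mdp_def
  by (intro mult_left_mono sum_mono) auto

text \<open>By monotonicity the image lies between the images of the constant vectors with entries
  \<open>- B\<close> and \<open>B\<close>.\<close>

lemma infnorm_lift_trans_le:
  assumes "\<And>s. \<bar>v $ s\<bar> \<le> B"
  shows "infnorm (lift_trans M v) \<le> disc M * B"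
proof (rule infnorm_cart_le)
  fix sa
  have "v $ s \<le> (B *\<^sub>R 1 :: real^'s) $ s" "((- B) *\<^sub>R 1 :: real^'s) $ s \<le> v $ s" for s
    using assms[of s] by auto
  then have "lift_trans M v $ sa \<le> lift_trans M (B *\<^sub>R 1) $ sa"
    "lift_trans M ((- B) *\<^sub>R 1) $ sa \<le> lift_trans M v $ sa"
    by (intro lift_trans_mono; blast)+
  then show "\<bar>lift_trans M v $ sa\<bar> \<le> disc M * B"
    unfolding lift_trans_const by simp
qed

lemma infnorm_A_mat_le: "infnorm (A_mat M \<pi> *v x) \<le> disc M * infnorm x"
  unfolding A_mat_mult by (intro infnorm_lift_trans_le) (simp add: pol_mat_nth component_le_infnorm_cart)

lemma A_mat_one: "A_mat M \<pi> *v (c *\<^sub>R 1) = (disc M * c) *\<^sub>R 1"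
proof -
  have "pol_mat \<pi> *v (c *\<^sub>R 1) = (c *\<^sub>R 1 :: real^'s)" by (simp add: vec_eq_iff pol_mat_nth)
  then show ?thesis by (simp add: A_mat_mult lift_trans_const)
qed

text \<open>At a minimal entry \<open>m\<close> of \<open>d\<close> the hypothesis gives \<open>m \<ge> disc M * m\<close>.\<close>

lemma A_mat_supersolution_nonneg:
  assumes "\<And>sa. (A_mat M \<pi> *v d) $ sa \<le> d $ sa"
  shows "0 \<le> d $ sa"
proof -
  obtain i where i: "\<And>j. - d $ j \<le> - d $ i" using finite_type_max[of "\<lambda>i. - d $ i"] by metis
  have "((d $ i) *\<^sub>R 1 :: real^'s) $ s \<le> (pol_mat \<pi> *v d) $ s" for s
    using i by (simp add: pol_mat_nth)
  then have "lift_trans M ((d $ i) *\<^sub>R 1) $ i \<le> (A_mat M \<pi> *v d) $ i"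
    unfolding A_mat_mult by (rule lift_trans_mono)
  also have "\<dots> \<le> d $ i" by (rule assms)
  finally have "0 \<le> (1 - disc M) * d $ i" by (simp add: lift_trans_const algebra_simps)
  then have "0 \<le> d $ i" using disc_bounds by (simp add: zero_le_mult_iff)
  then show ?thesis using i[of sa] by simp
qed

text \<open>The return is a Neumann series, dominated geometrically in the maximum norm; splitting
  off the term at time 0 gives the policy evaluation equation.\<close>

lemma Qpol_fixed_point: "Qpol M \<pi> = rew_vec M + A_mat M \<pi> *v Qpol M \<pi>"
proof -
  define f where "f t = disc M ^ t *\<^sub>R ((*v) (trans_mat M ** pol_mat \<pi>) ^^ t) (rew_vec M)" for t
  have f0: "f 0 = rew_vec M" by (simp add: f_def)
  have fSuc: "f (Suc t) = A_mat M \<pi> *v f t" for t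
    by (simp add: f_def A_mat_def matrix_vector_mult_scaleR scaleR_matrix_vector_assoc[symmetric])
  have inf: "infnorm (f t) \<le> disc M ^ t * infnorm (rew_vec M)" for t
  proof (induction t)
    case (Suc t)
    have "infnorm (f (Suc t)) \<le> disc M * infnorm (f t)" unfolding fSuc by (rule infnorm_A_mat_le)
    also have "\<dots> \<le> disc M * (disc M ^ t * infnorm (rew_vec M))"
      using Suc disc_bounds by (intro mult_left_mono) auto
    finally show ?case by (simp add: mult.assoc)
  qed (simp add: f0)
  have "norm (f t) \<le> sqrt DIM(real^('s \<times> 'a)) * (disc M ^ t * infnorm (rew_vec M))" for t
    by (rule order_trans[OF norm_le_infnorm mult_left_mono[OF inf]]) simp
  moreover have "summable (\<lambda>t. sqrt DIM(real^('s \<times> 'a)) * (disc M ^ t * infnorm (rew_vec M)))"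
    using disc_bounds by (intro summable_mult summable_mult2 summable_geometric) auto
  ultimately have sum: "summable f" by (blast intro: summable_comparison_test')
  have Q: "Qpol M \<pi> = suminf f" by (simp add: Qpol_def f_def[abs_def])
  have "suminf f = f 0 + (\<Sum>t. f (Suc t))" using suminf_split_head[OF sum] by simp
  also have "(\<Sum>t. f (Suc t)) = A_mat M \<pi> *v suminf f"
    unfolding fSuc by (rule bounded_linear.suminf[OF matrix_vector_mul_bounded_linear sum, symmetric])
  finally show ?thesis unfolding Q f0 .
qed

text \<open>Policy improvement: a deterministic policy \<open>\<pi>\<close> whose values have maximal sum cannot be improved
  strictly by its greedy policy, so its Q-function is a fixed point of \<open>bellman M\<close>; by comparison
  that fixed point dominates every \<open>Qpol M \<sigma>\<close>.\<close>

lemma Qstar_fixed_point: "bellman M (Qstar M) = Qstar M"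
proof -
  obtain \<pi> where \<pi>: "\<And>\<sigma>. (\<Sum>sa\<in>UNIV. Qpol M \<sigma> $ sa) \<le> (\<Sum>sa\<in>UNIV. Qpol M \<pi> $ sa)"
    using finite_type_max[of "\<lambda>\<sigma>. \<Sum>sa\<in>UNIV. Qpol M \<sigma> $ sa"] by metis
  define Q where "Q = Qpol M \<pi>"
  obtain \<sigma> where \<sigma>: "state_max Q = pol_mat \<sigma> *v Q" by (rule state_max_policy)
  have b: "bellman M Q = rew_vec M + A_mat M \<sigma> *v Q" by (simp add: bellman_eq \<sigma> A_mat_mult)
  have Qle: "(rew_vec M + A_mat M \<tau> *v P) $ sa \<le> bellman M P $ sa" for \<tau> P sa
    using lift_trans_mono[of "pol_mat \<tau> *v P" "state_max P" sa]
    by (simp add: A_mat_mult bellman_eq pol_mat_nth state_max_ge)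
  \<comment> \<open>Since \<open>Q = rew_vec M + A_mat M \<pi> *v Q\<close> is at most
    \<open>bellman M Q\<close>, the difference \<open>d = Qpol M \<sigma> - Q\<close> satisfies
    \<open>A_mat M \<sigma> *v d \<le> d\<close> entrywise.\<close>
  have imp: "Q $ sa \<le> Qpol M \<sigma> $ sa" for sa
  proof -
    have "(A_mat M \<sigma> *v (Qpol M \<sigma> - Q)) $ i \<le> (Qpol M \<sigma> - Q) $ i" for i
      using Qle[of \<pi> Q i] Qpol_fixed_point[of \<pi>] Qpol_fixed_point[of \<sigma>]
      unfolding b Q_def[symmetric] matrix_vector_mult_diff_distrib
      by (metis add_diff_cancel_left diff_left_mono vector_minus_component)
    then show ?thesis using A_mat_supersolution_nonneg[of \<sigma> "Qpol M \<sigma> - Q" sa] by simp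
  qed
  \<comment> \<open>A strict improvement in one entry would contradict the maximality of the sum for
    \<pi>.\<close>
  have "Qpol M \<sigma> $ sa = Q $ sa" for sa
  proof (rule ccontr)
    assume "Qpol M \<sigma> $ sa \<noteq> Q $ sa"
    then have "Q $ sa < Qpol M \<sigma> $ sa" using imp[of sa] by simp
    then have "(\<Sum>sa\<in>UNIV. Q $ sa) < (\<Sum>sa\<in>UNIV. Qpol M \<sigma> $ sa)"
      using imp by (intro sum_strict_mono_ex1 ballI bexI[of _ sa]) simp_all
    then show False using \<pi>[of \<sigma>] by (simp add: Q_def)
  qed
  then have "Qpol M \<sigma> = Q" by (simp add: vec_eq_iff)
  then have fp: "bellman M Q = Q" using b Qpol_fixed_point[of \<sigma>] by simp
  have dom: "Qpol M \<tau> $ sa \<le> Q $ sa" for \<tau> sa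
  proof -
    have "(A_mat M \<tau> *v (Q - Qpol M \<tau>)) $ i \<le> (Q - Qpol M \<tau>) $ i" for i
      using Qle[of \<tau> Q i] Qpol_fixed_point[of \<tau>]
      unfolding fp matrix_vector_mult_diff_distrib
      by (metis add_diff_cancel_left diff_right_mono vector_minus_component)
    then show ?thesis using A_mat_supersolution_nonneg[of \<tau> "Q - Qpol M \<tau>" sa] by simp
  qed
  have "Qstar M $ sa = Q $ sa" for sa
    unfolding Qstar_def vec_lambda_beta using dom[of _ sa] by (intro Max_eqI) (auto simp: Q_def)
  then have "Qstar M = Q" by (simp add: vec_eq_iff)
  then show ?thesis using fp by simp
qed

lemma bellman_diff:
  "bellman M Q - Qstar M = lift_trans M (state_max Q - state_max (Qstar M))"
proof -
  have "bellman M Q - Qstar M = bellman M Q - bellman M (Qstar M)" by (simp only: Qstar_fixed_point)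
  then show ?thesis by (simp add: bellman_eq lift_trans_diff)
qed

end

text \<open>Induction on the number of coordinates of \<open>v\<close> that are not entries of \<open>x\<close>: such a coordinate lies
  between two entries, so \<open>v\<close> lies on a segment between vectors with fewer such coordinates.\<close>

lemma convex_hull_policies:
  fixes x :: "real^('s::finite \<times> 'a::finite)" and v :: "real^'s"
  assumes "\<And>s. \<exists>a. x $ (s, a) \<le> v $ s" "\<And>s. \<exists>a. v $ s \<le> x $ (s, a)"
  shows "v \<in> convex hull (range (\<lambda>\<pi>. pol_mat \<pi> *v x))"
proof -
  let ?H = "convex hull (range (\<lambda>\<pi>. pol_mat \<pi> *v x))"
  have "v \<in> ?H"
    if "finite T" "\<And>s. s \<in> T \<Longrightarrow> \<exists>a. x $ (s, a) \<le> v $ s" "\<And>s. s \<in> T \<Longrightarrow> \<exists>a. v $ s \<le> x $ (s, a)"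
      "\<And>s. s \<notin> T \<Longrightarrow> \<exists>a. v $ s = x $ (s, a)" for T v
    using that
  proof (induction T arbitrary: v)
    case empty
    then obtain \<pi> where "\<And>s. v $ s = x $ (s, \<pi> s)" by (metis empty_iff)
    then have "v = pol_mat \<pi> *v x" by (simp add: vec_eq_iff pol_mat_nth)
    then show ?case by (auto intro: hull_inc)
  next
    case (insert t T)
    obtain a b where ab: "x $ (t, a) \<le> v $ t" "v $ t \<le> x $ (t, b)" using insert.prems by blast
    \<comment> \<open>\<open>w r\<close> replaces coordinate \<open>t\<close> of \<open>v\<close> by
      \<open>r\<close>. For \<open>r\<close> an entry of \<open>x\<close> at \<open>t\<close>, only
      the coordinates in \<open>T\<close> remain to be treated.\<close>
    define w where "w r = (\<chi> s. if s = t then r else v $ s)" for r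
    have w: "w (x $ (t, c)) \<in> ?H" for c
    proof (rule insert.IH)
      show "\<exists>a. x $ (s, a) \<le> w (x $ (t, c)) $ s" if "s \<in> T" for s
        using insert.prems(1)[of s] insert.hyps that by (auto simp: w_def)
      show "\<exists>a. w (x $ (t, c)) $ s \<le> x $ (s, a)" if "s \<in> T" for s
        using insert.prems(2)[of s] insert.hyps that by (auto simp: w_def)
      show "\<exists>a. w (x $ (t, c)) $ s = x $ (s, a)" if "s \<notin> T" for s
        using insert.prems(3)[of s] that by (auto simp: w_def)
    qed
    have "v $ t \<in> closed_segment (x $ (t, a)) (x $ (t, b))"
      using ab by (simp add: closed_segment_eq_real_ivl)
    then obtain u where u: "0 \<le> u" "u \<le> 1" "v $ t = (1 - u) * x $ (t, a) + u * x $ (t, b)"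
      by (auto simp: closed_segment_def)
    have "v = (1 - u) *\<^sub>R w (x $ (t, a)) + u *\<^sub>R w (x $ (t, b))"
      by (simp add: vec_eq_iff w_def u(3)) (simp add: algebra_simps)
    moreover have "(1 - u) *\<^sub>R w (x $ (t, a)) + u *\<^sub>R w (x $ (t, b)) \<in> ?H"
      using u by (intro convexD[OF convex_convex_hull] w) auto
    ultimately show ?case by simp
  qed
  from this[of UNIV] assms show ?thesis by auto
qed

text \<open>A maximizer of \<open>Q'\<close> supplies an entry of \<open>Q - Q'\<close> below the
  difference of the maxima, a maximizer of \<open>Q\<close> one above it.\<close>

lemma state_max_diff_in_hull:
  "state_max Q - state_max Q' \<in> convex hull (range (\<lambda>\<pi>. pol_mat \<pi> *v (Q - Q')))"
proof (rule convex_hull_policies)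
  fix s
  obtain a where a: "state_max Q' $ s = Q' $ (s, a)" by (rule state_max_attained)
  then have "(Q - Q') $ (s, a) \<le> (state_max Q - state_max Q') $ s" using state_max_ge[of Q s a] by simp
  then show "\<exists>a. (Q - Q') $ (s, a) \<le> (state_max Q - state_max Q') $ s" ..
  obtain b where b: "state_max Q $ s = Q $ (s, b)" by (rule state_max_attained)
  then have "(state_max Q - state_max Q') $ s \<le> (Q - Q') $ (s, b)" using state_max_ge[of Q' s b] by simp
  then show "\<exists>a. (state_max Q - state_max Q') $ s \<le> (Q - Q') $ (s, a)" ..
qed

lemma state_max_diff_abs_le: "\<bar>(state_max Q - state_max Q') $ s\<bar> \<le> infnorm (Q - Q')"
proof -
  obtain a where a: "state_max Q' $ s = Q' $ (s, a)" by (rule state_max_attained)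
  obtain b where b: "state_max Q $ s = Q $ (s, b)" by (rule state_max_attained)
  show ?thesis
    using a b state_max_ge[of Q s a] state_max_ge[of Q' s b]
      component_le_infnorm_cart[of "Q - Q'" "(s, a)"] component_le_infnorm_cart[of "Q - Q'" "(s, b)"]
    by simp
qed

section \<open>Projected dynamics and identification\<close>

lemma proj_perp_mult: "proj_perp *v y = y - ((\<Sum>j\<in>UNIV. y $ j) / real CARD('n)) *\<^sub>R (1 :: real^'n)"
proof -
  have "(\<chi> i j. 1) *v y = (\<Sum>j\<in>UNIV. y $ j) *\<^sub>R (1 :: real^'n)"
    by (simp add: vec_eq_iff matrix_vector_mult_def)
  then show ?thesis
    by (simp add: proj_perp_def matrix_vector_mult_diff_rdistrib scaleR_matrix_vector_assoc[symmetric])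
qed

lemma proj_perp_one: "proj_perp *v (c *\<^sub>R (1 :: real^'n)) = 0"
  by (simp add: proj_perp_mult vec_eq_iff)

lemma proj_perp_add_const: "proj_perp *v (y + c *\<^sub>R (1 :: real^'n)) = proj_perp *v y"
  by (simp add: matrix_vector_right_distrib proj_perp_one)

lemma proj_perp_idem: "proj_perp *v (proj_perp *v y) = proj_perp *v (y :: real^'n)"
proof -
  have "proj_perp *v y = y + (- ((\<Sum>j\<in>UNIV. y $ j) / real CARD('n))) *\<^sub>R 1"
    by (simp add: proj_perp_mult)
  then show ?thesis by (simp only: proj_perp_add_const)
qed

text \<open>Pythagoras: \<open>proj_perp *v y\<close> is orthogonal to the constant vector that was
  subtracted.\<close>

lemma norm_proj_perp_le: "norm (proj_perp *v (y :: real^'n)) \<le> norm y"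
proof -
  define c where "c = (\<Sum>j\<in>UNIV. y $ j) / real CARD('n)"
  have y: "y = proj_perp *v y + c *\<^sub>R 1" by (simp add: proj_perp_mult c_def)
  have "orthogonal (proj_perp *v y) (c *\<^sub>R 1)"
    by (simp add: orthogonal_def proj_perp_mult inner_vec_def sum_subtractf sum_distrib_right[symmetric])
  then have "norm y ^ 2 = norm (proj_perp *v y) ^ 2 + norm (c *\<^sub>R (1 :: real^'n)) ^ 2"
    by (subst y) (rule norm_add_Pythagorean)
  then have "norm (proj_perp *v y) ^ 2 \<le> norm y ^ 2" by simp
  then show ?thesis by (rule power2_le_imp_le) simp
qed

lemma X1_eq: "X1 M = range (\<lambda>c. Qstar M + c *\<^sub>R 1)"
  by (auto simp: X1_def span_singleton)

text \<open>Shifting \<open>Qstar M\<close> by the mean of the difference attains the value. No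
  shift does better, because the projection ignores constants and does not increase the
  norm.\<close>

lemma infdist_X1: "infdist Q (X1 M) = norm (proj_perp *v (Q - Qstar M))"
proof (rule antisym)
  define c where "c = (\<Sum>j\<in>UNIV. (Q - Qstar M) $ j) / real CARD('a \<times> 'b)"
  have "dist Q (Qstar M + c *\<^sub>R 1) = norm (proj_perp *v (Q - Qstar M))"
    by (simp only: proj_perp_mult dist_norm c_def diff_diff_eq)
  then show "infdist Q (X1 M) \<le> norm (proj_perp *v (Q - Qstar M))"
    by (intro infdist_le2[of "Qstar M + c *\<^sub>R 1"]) (auto simp: X1_eq)
next
  have "norm (proj_perp *v (Q - Qstar M)) \<le> dist Q (Qstar M + c *\<^sub>R 1)" for c
    using norm_proj_perp_le[of "Q - Qstar M + (- c) *\<^sub>R 1"]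
    unfolding proj_perp_add_const by (simp add: dist_norm diff_diff_eq)
  then show "norm (proj_perp *v (Q - Qstar M)) \<le> infdist Q (X1 M)"
    unfolding X1_eq by (subst infdist_notempty) (auto intro!: cINF_greatest)
qed

section \<open>Greedy actions and the action gap\<close>

lemma Argmax_iff: "a \<in> Argmax Q s \<longleftrightarrow> (\<forall>b. Q $ (s, b) \<le> Q $ (s, a))"
  by (auto simp: Argmax_def is_arg_max_linorder)

lemma Argmax_iff_state_max: "a \<in> Argmax Q s \<longleftrightarrow> state_max Q $ s = Q $ (s, a)"
  unfolding Argmax_iff by (metis state_max_attained state_max_ge order_antisym)

lemma Argmax_nonempty: "Argmax Q s \<noteq> {}"
  using state_max_attained[of Q s] Argmax_iff_state_max by (metis empty_iff)

lemma Thetastar_nonempty: "Thetastar M \<noteq> {}"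
proof -
  have "\<forall>s. \<exists>a. a \<in> Phistar M s" unfolding Phistar_def using Argmax_nonempty by blast
  then have "\<exists>\<pi>. \<forall>s. \<pi> s \<in> Phistar M s" by (rule choice)
  then show ?thesis by (auto simp: Thetastar_def)
qed

lemma rho_star_le_rho_bar: "rho_star M \<le> rho_bar M"
  unfolding rho_star_def rho_bar_def by (intro jsr_mono) (auto simp: Thetastar_nonempty)

lemma gap_at_le:
  assumes "a \<notin> Phistar M s"
  shows "Qstar M $ (s, a) + gap_at M s \<le> state_max (Qstar M) $ s"
proof -
  have "Qstar M $ (s, a) \<le> (MAX a \<in> - Phistar M s. Qstar M $ (s, a))"
    using assms by (intro Max_ge) auto
  then show ?thesis by (simp add: gap_at_def Vstar_def state_max_def)
qed

lemma gap_le: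
  assumes "a \<notin> Phistar M s"
  shows "Qstar M $ (s, a) + gap M \<le> state_max (Qstar M) $ s"
proof -
  have "s \<in> Ssep M" using assms by (auto simp: Ssep_def)
  then have "gap M \<le> gap_at M s" unfolding gap_def by (intro Min_le) auto
  then show ?thesis using gap_at_le[OF assms] by simp
qed

text \<open>The best suboptimal value is attained by some suboptimal action, so each of the finitely
  many gaps is strictly positive.\<close>

lemma gap_pos:
  assumes "Ssep M \<noteq> {}"
  shows "0 < gap M"
proof -
  have "0 < gap_at M s" if "s \<in> Ssep M" for s
  proof -
    have "- Phistar M s \<noteq> {}" using that by (auto simp: Ssep_def)
    then have "(MAX a \<in> - Phistar M s. Qstar M $ (s, a)) \<in> (\<lambda>a. Qstar M $ (s, a)) ` (- Phistar M s)"
      by (intro Max_in) auto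
    then obtain a where a: "a \<notin> Phistar M s" "(MAX a \<in> - Phistar M s. Qstar M $ (s, a)) = Qstar M $ (s, a)"
      by auto
    have "Qstar M $ (s, a) < state_max (Qstar M) $ s"
      using a(1) state_max_ge[of "Qstar M" s a] by (simp add: Phistar_def Argmax_iff_state_max)
    then show ?thesis by (simp add: gap_at_def a(2) Vstar_def state_max_def)
  qed
  then show ?thesis unfolding gap_def using assms by (subst Min_gr_iff) auto
qed

text \<open>A constant shift does not affect comparisons between actions. The remaining perturbation
  is below \<open>gap M / 2\<close> in each entry, so two entries together cannot lift a suboptimal
  action to an optimal one.\<close>

lemma Argmax_subset_Phistar:
  assumes "infdist Q (X1 M) < gap M / 2"
  shows "Argmax Q s \<subseteq> Phistar M s"
proof (rule ccontr)
  assume "\<not> Argmax Q s \<subseteq> Phistar M s"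
  then obtain a where a: "a \<in> Argmax Q s" "a \<notin> Phistar M s" by blast
  obtain b where b: "state_max (Qstar M) $ s = Qstar M $ (s, b)" by (rule state_max_attained)
  define c where "c = (\<Sum>j\<in>UNIV. (Q - Qstar M) $ j) / real CARD('a \<times> 'b)"
  define y where "y = proj_perp *v (Q - Qstar M)"
  have Q: "Q $ i = Qstar M $ i + c + y $ i" for i
    by (simp add: y_def proj_perp_mult c_def)
  have y: "\<bar>y $ i\<bar> < gap M / 2" for i
    using assms component_le_norm_cart[of y i] by (simp add: infdist_X1 y_def)
  have "Q $ (s, b) \<le> Q $ (s, a)" using a(1) by (simp add: Argmax_iff)
  then show False using gap_le[OF a(2)] b Q[of "(s, a)"] Q[of "(s, b)"] y[of "(s, a)"] y[of "(s, b)"]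
    by linarith
qed

lemma X1_psubset_Xstar:
  assumes "Ssep M \<noteq> {}" "tie_breaking tb"
  shows "X1 M \<subset> Xstar M tb"
proof -
  have greedy_in: "greedy tb Q s \<in> Argmax Q s" for Q s
    using assms(2) Argmax_nonempty[of Q s] by (simp add: greedy_def tie_breaking_def)
  have "Argmax (Qstar M + c *\<^sub>R 1) s = Phistar M s" for c s
    by (auto simp: Phistar_def Argmax_iff)
  then have sub: "X1 M \<subseteq> Xstar M tb"
    using greedy_in unfolding X1_eq Xstar_def by (smt (verit) image_subset_iff mem_Collect_eq)
  obtain s where s: "s \<in> Ssep M" using assms(1) by blast
  obtain a where a: "a \<in> Phistar M s" using Argmax_nonempty unfolding Phistar_def by blast
  obtain b where b: "b \<notin> Phistar M s" using s by (auto simp: Ssep_def)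
  \<comment> \<open>Witness of strictness: rewarding one optimal action keeps every greedy action
    optimal, but the perturbation is 1 at \<open>a\<close> and 0 at \<open>b\<close>, hence not
    constant.\<close>
  define Q where "Q = Qstar M + axis (s, a) 1"
  have Q: "Q $ (t, c) = Qstar M $ (t, c) + (if t = s \<and> c = a then 1 else 0)" for t c
    by (auto simp: Q_def axis_def)
  have "Argmax Q t \<subseteq> Phistar M t" for t
  proof
    fix c assume c: "c \<in> Argmax Q t"
    show "c \<in> Phistar M t"
    proof (cases "t = s")
      case True
      have "Q $ (s, a) \<le> Q $ (s, c)" "Qstar M $ (s, c) \<le> Qstar M $ (s, a)"
        using c a True by (auto simp: Argmax_iff Phistar_def)
      then have "c = a" by (auto simp: Q split: if_splits)
      then show ?thesis using a True by simp
    next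
      case False
      then show ?thesis using c by (simp add: Phistar_def Argmax_iff Q)
    qed
  qed
  then have "Q \<in> Xstar M tb" using greedy_in by (auto simp: Xstar_def)
  moreover have "Q \<notin> X1 M"
  proof
    assume "Q \<in> X1 M"
    then obtain c where "Q = Qstar M + c *\<^sub>R 1" by (auto simp: X1_eq)
    then have "Q $ (s, a) = Qstar M $ (s, a) + c" "Q $ (s, b) = Qstar M $ (s, b) + c" by auto
    moreover have "b \<noteq> a" using a b by auto
    ultimately show False by (simp add: Q)
  qed
  ultimately show ?thesis using sub by blast
qed

section \<open>Projected trajectories and the identification time\<close>

lemma Qiter_Suc: "Qiter M Q0 (Suc k) = bellman M (Qiter M Q0 k)"
  by (simp add: Qiter_def)

lemma infdist_Qiter: "infdist (Qiter M Q0 k) (X1 M) = norm (zvec M Q0 k)"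
  by (simp add: infdist_X1 zvec_def)

context
  fixes M :: "('s::finite, 'a::finite) mdp"
  assumes mdp: "is_mdp M"
begin

text \<open>The inner projection changes \<open>x\<close> by a constant vector, which
  \<open>A_mat M \<pi>\<close> keeps constant and the outer projection annihilates.\<close>

lemma proj_perp_A_mat_proj_perp:
  "proj_perp *v (A_mat M \<pi> *v (proj_perp *v x)) = proj_perp *v (A_mat M \<pi> *v x)"
proof -
  define c where "c = (\<Sum>j\<in>UNIV. x $ j) / real CARD('s \<times> 'a)"
  have "proj_perp *v x = x + (- c) *\<^sub>R 1" by (simp add: proj_perp_mult c_def)
  then show ?thesis
    by (simp only: matrix_vector_right_distrib A_mat_one[OF mdp] proj_perp_one add_0_right)
qed

lemma Abar_mat_mult: "Abar_mat M \<pi> *v x = proj_perp *v (A_mat M \<pi> *v x)"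
  using proj_perp_A_mat_proj_perp[of \<pi> x] by (simp add: Abar_mat_def matrix_vector_mul_assoc matrix_mul_assoc)

lemma Abar_mat_proj_perp: "Abar_mat M \<pi> *v (proj_perp *v x) = proj_perp *v (A_mat M \<pi> *v x)"
  by (simp only: Abar_mat_mult proj_perp_A_mat_proj_perp)

text \<open>The witness \<open>y\<close> is the corresponding product of unprojected matrices
  applied to \<open>x\<close>. Each of these contracts the maximum norm by \<open>disc M\<close>,
  whereas the projection may increase that norm; it is therefore applied only once, at the
  end.\<close>

lemma Abar_word_bound:
  assumes "set xs \<subseteq> range (Abar_mat M)"
  shows "\<exists>y. proj_perp *v (word_prod xs *v x) = proj_perp *v y \<and>
    infnorm y \<le> disc M ^ length xs * infnorm x"
  using assms
proof (induction xs)
  case (Cons B xs)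
  then obtain \<pi> y where B: "B = Abar_mat M \<pi>"
    and y: "proj_perp *v (word_prod xs *v x) = proj_perp *v y" "infnorm y \<le> disc M ^ length xs * infnorm x"
    by auto
  have "proj_perp *v (word_prod (B # xs) *v x) = proj_perp *v (Abar_mat M \<pi> *v (word_prod xs *v x))"
    by (simp add: B matrix_vector_mul_assoc)
  also have "\<dots> = proj_perp *v (A_mat M \<pi> *v (proj_perp *v (word_prod xs *v x)))"
    by (simp only: Abar_mat_mult proj_perp_idem proj_perp_A_mat_proj_perp)
  also have "\<dots> = proj_perp *v (A_mat M \<pi> *v y)"
    by (simp only: y(1) proj_perp_A_mat_proj_perp)
  finally have "proj_perp *v (word_prod (B # xs) *v x) = proj_perp *v (A_mat M \<pi> *v y)" .
  moreover have "disc M * infnorm y \<le> disc M * (disc M ^ length xs * infnorm x)"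
    using disc_bounds[OF mdp] by (intro mult_left_mono y) auto
  then have "infnorm (A_mat M \<pi> *v y) \<le> disc M ^ length (B # xs) * infnorm x"
    using infnorm_A_mat_le[OF mdp, of \<pi> y] by (simp add: mult.assoc)
  ultimately show ?case by blast
qed auto

lemma rho_bar_le_disc: "rho_bar M \<le> disc M"
  unfolding rho_bar_def
proof (rule jsr_le)
  \<comment> \<open>The 1 covers the empty word; the square root passes from the maximum norm to the
    Euclidean norm.\<close>
  let ?C = "1 + sqrt DIM(real^('s \<times> 'a))"
  fix xs assume xs: "set xs \<subseteq> range (Abar_mat M)"
  show "onorm ((*v) (word_prod xs)) \<le> ?C * disc M ^ length xs"
  proof (rule onorm_le)
    fix x
    show "norm (word_prod xs *v x) \<le> ?C * disc M ^ length xs * norm x"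
    proof (cases xs)
      case Nil
      then show ?thesis by (simp add: algebra_simps)
    next
      case (Cons B ys)
      then obtain \<pi> where B: "B = Abar_mat M \<pi>" using xs by auto
      have "word_prod xs *v x = Abar_mat M \<pi> *v (word_prod ys *v x)"
        by (simp add: Cons B matrix_vector_mul_assoc)
      \<comment> \<open>A nonempty word starts with a projection, so projecting once more changes
        nothing.\<close>
      then have "word_prod xs *v x = proj_perp *v (word_prod xs *v x)"
        by (simp only: Abar_mat_mult proj_perp_idem)
      moreover obtain y where y: "proj_perp *v (word_prod xs *v x) = proj_perp *v y"
        "infnorm y \<le> disc M ^ length xs * infnorm x"
        using Abar_word_bound[OF xs] by blast
      ultimately have "norm (word_prod xs *v x) \<le> norm y" using norm_proj_perp_le[of y] by simp
      also have "\<dots> \<le> sqrt DIM(real^('s \<times> 'a)) * infnorm y" by (rule norm_le_infnorm)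
      also have "\<dots> \<le> ?C * (disc M ^ length xs * norm x)"
      proof (rule mult_mono)
        show "infnorm y \<le> disc M ^ length xs * norm x"
          by (rule order_trans[OF y(2)], intro mult_left_mono infnorm_le_norm)
            (use disc_bounds[OF mdp] in auto)
      qed (auto simp: infnorm_pos_le add_nonneg_nonneg)
      finally show ?thesis by (simp only: mult.assoc)
    qed
  qed
qed (use disc_bounds[OF mdp] in \<open>auto intro: add_pos_nonneg\<close>)

text \<open>The linear map \<open>G\<close> carries the convex combination of policy evaluations of
  \<open>Q - Qstar M\<close> to one of projected switching matrices applied to the current
  \<open>zvec\<close>.\<close>

lemma zvec_Suc_in_hull:
  "zvec M Q0 (Suc k) \<in> convex hull ((\<lambda>A. A *v zvec M Q0 k) ` range (Abar_mat M))"
proof -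
  define Q where "Q = Qiter M Q0 k"
  define G where "G v = proj_perp *v lift_trans M v" for v
  have lin: "linear G"
    unfolding G_def using linear_compose[OF linear_lift_trans matrix_vector_mul_linear]
    by (simp add: o_def)
  have "zvec M Q0 (Suc k) = G (state_max Q - state_max (Qstar M))"
    by (simp add: zvec_def Qiter_Suc bellman_diff[OF mdp] G_def Q_def)
  also have "\<dots> \<in> convex hull (G ` range (\<lambda>\<pi>. pol_mat \<pi> *v (Q - Qstar M)))"
    using state_max_diff_in_hull[of Q "Qstar M"] by (simp add: convex_hull_linear_image[OF lin, symmetric])
  also have "G ` range (\<lambda>\<pi>. pol_mat \<pi> *v (Q - Qstar M)) = (\<lambda>A. A *v zvec M Q0 k) ` range (Abar_mat M)"
    by (simp add: image_image G_def zvec_def Abar_mat_proj_perp A_mat_mult Q_def)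
  finally show ?thesis .
qed

lemma zvec_bound:
  assumes "rho_bar M < \<beta>"
  shows "\<exists>C>0. \<forall>Q0 k. norm (zvec M Q0 k) \<le> C * \<beta> ^ k * norm (zvec M Q0 0)"
proof -
  obtain C where "C > 0"
    "\<And>z. (\<forall>k. z (Suc k) \<in> convex hull ((\<lambda>A. A *v z k) ` range (Abar_mat M))) \<Longrightarrow>
      (\<forall>k. norm (z k) \<le> C * \<beta> ^ k * norm (z 0))"
    using switched_system_bound[of "range (Abar_mat M)" \<beta>] assms unfolding rho_bar_def by auto
  then show ?thesis using zvec_Suc_in_hull by blast
qed

text \<open>A policy greedy for \<open>Q\<close> is here also greedy for \<open>Qstar M\<close>, so
  both maxima are read off at the same action in every state.\<close>

lemma identified_step:
  assumes "infdist Q (X1 M) < gap M / 2"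
  shows "\<exists>\<pi>\<in>Thetastar M. bellman M Q - Qstar M = A_mat M \<pi> *v (Q - Qstar M)"
proof -
  have "\<forall>s. \<exists>a. a \<in> Argmax Q s" using Argmax_nonempty by blast
  then obtain \<pi> where \<pi>: "\<And>s. \<pi> s \<in> Argmax Q s" by metis
  then have \<pi>': "\<pi> s \<in> Phistar M s" for s using Argmax_subset_Phistar[OF assms] by blast
  have "state_max Q - state_max (Qstar M) = pol_mat \<pi> *v (Q - Qstar M)"
    using \<pi> \<pi>' by (simp add: vec_eq_iff pol_mat_nth Argmax_iff_state_max Phistar_def)
  then have "bellman M Q - Qstar M = A_mat M \<pi> *v (Q - Qstar M)"
    by (simp add: bellman_diff[OF mdp] A_mat_mult)
  then show ?thesis using \<pi>' by (auto simp: Thetastar_def)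
qed

text \<open>\<open>K_id\<close> comes from solving \<open>\<beta> ^ k * d < gap M / 2\<close> for
  \<open>k\<close> by logarithms, where \<beta> and \<open>d\<close> are as in the proof.\<close>

lemma infdist_after_K_id:
  assumes "Ssep M \<noteq> {}" and ids: "id_consts M \<epsilon>0 c0" and k: "K_id M \<epsilon>0 c0 Q0 \<le> k"
  shows "infdist (Qiter M Q0 k) (X1 M) < gap M / 2"
proof -
  define \<beta> and d :: real where "\<beta> = rho_bar M + \<epsilon>0" and "d = c0 * infdist Q0 (X1 M)"
  have \<beta>: "0 < \<beta>" "\<beta> < 1" and le: "infdist (Qiter M Q0 k) (X1 M) \<le> \<beta> ^ k * d" and d0: "0 \<le> d"
    using ids by (auto simp: id_consts_def \<beta>_def d_def infdist_nonneg mult_ac)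
  note gap = gap_pos[OF assms(1)]
  have "\<beta> ^ k * d < gap M / 2"
  proof (cases "d < gap M / 2")
    case True
    have "\<beta> ^ k * d \<le> d" using \<beta> d0 by (intro mult_left_le_one_le power_le_one) auto
    then show ?thesis using True by simp
  next
    case False
    then have d: "0 < d" using gap by simp
    define x where "x = ln (2 * d / gap M) / (- ln \<beta>)"
    have "nat \<lfloor>x\<rfloor> + 1 \<le> k"
      using k False by (simp add: K_id_def d_def \<beta>_def x_def mult.assoc)
    \<comment> \<open>Adding 1 to the floor makes the inequality strict.\<close>
    then have "x < real k" by linarith
    then have "ln (2 * d / gap M) < real k * (- ln \<beta>)"
      using \<beta> unfolding x_def by (subst (asm) pos_divide_less_eq) auto
    then have "ln (2 * d / gap M) + ln (\<beta> ^ k) < 0" using \<beta> by (simp add: ln_realpow)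
    moreover have "ln (2 * d / gap M * \<beta> ^ k) = ln (2 * d / gap M) + ln (\<beta> ^ k)"
      using \<beta> d gap by (intro ln_mult_pos) auto
    ultimately have "ln (2 * d / gap M * \<beta> ^ k) < 0" by simp
    moreover have "0 < 2 * d / gap M * \<beta> ^ k" using \<beta> d gap by simp
    ultimately have "2 * d / gap M * \<beta> ^ k < 1" by (simp only: ln_less_zero_iff)
    then show ?thesis using gap by (simp add: field_simps)
  qed
  then show ?thesis using le by simp
qed

text \<open>From \<open>K_id\<close> on, each step applies a single matrix of the optimal family, so
  the switched system bound for that family holds for the shifted sequence. \<open>C\<close> is
  obtained before the identification constants and \<open>Q0\<close>, which makes it uniform in
  them.\<close>

lemma zvec_bound_after_K_id:
  assumes "Ssep M \<noteq> {}" "rho_star M < \<beta>"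
  shows "\<exists>C>0. \<forall>\<epsilon>0 c0 Q0. id_consts M \<epsilon>0 c0 \<longrightarrow>
    (\<forall>l. norm (zvec M Q0 (K_id M \<epsilon>0 c0 Q0 + l)) \<le> C * \<beta> ^ l * norm (zvec M Q0 (K_id M \<epsilon>0 c0 Q0)))"
proof -
  obtain C where C: "C > 0"
    "\<And>z. (\<And>k. z (Suc k) \<in> convex hull ((\<lambda>A. A *v z k) ` Abar_mat M ` Thetastar M)) \<Longrightarrow>
      (\<forall>k. norm (z k) \<le> C * \<beta> ^ k * norm (z 0))"
    using switched_system_bound[of "Abar_mat M ` Thetastar M" \<beta>] assms(2) Thetastar_nonempty[of M]
    unfolding rho_star_def by auto
  show ?thesis
  proof (intro exI[of _ C] conjI C(1) allI impI)
    fix \<epsilon>0 c0 Q0 l assume ids: "id_consts M \<epsilon>0 c0"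
    define K where "K = K_id M \<epsilon>0 c0 Q0"
    have "zvec M Q0 (K + Suc k) \<in> convex hull ((\<lambda>A. A *v zvec M Q0 (K + k)) ` Abar_mat M ` Thetastar M)" for k
    proof -
      have "infdist (Qiter M Q0 (K + k)) (X1 M) < gap M / 2"
        by (rule infdist_after_K_id[OF assms(1) ids]) (simp add: K_def)
      then obtain \<pi> where \<pi>: "\<pi> \<in> Thetastar M"
        "bellman M (Qiter M Q0 (K + k)) - Qstar M = A_mat M \<pi> *v (Qiter M Q0 (K + k) - Qstar M)"
        using identified_step by blast
      then have "zvec M Q0 (K + Suc k) = Abar_mat M \<pi> *v zvec M Q0 (K + k)"
        by (simp add: zvec_def Qiter_Suc Abar_mat_proj_perp)
      then show ?thesis using \<pi>(1) by (auto intro: hull_inc)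
    qed
    then show "norm (zvec M Q0 (K + l)) \<le> C * \<beta> ^ l * norm (zvec M Q0 K)"
      using C(2)[of "\<lambda>k. zvec M Q0 (K + k)"] by simp
  qed
qed

section \<open>Contraction of the unprojected error\<close>

lemma infnorm_Qiter_bound:
  "infnorm (Qiter M Q0 (j + l) - Qstar M) \<le> disc M ^ l * infnorm (Qiter M Q0 j - Qstar M)"
proof (induction l)
  case (Suc l)
  have "infnorm (Qiter M Q0 (j + Suc l) - Qstar M) \<le> disc M * infnorm (Qiter M Q0 (j + l) - Qstar M)"
    unfolding add_Suc_right Qiter_Suc bellman_diff[OF mdp]
    by (intro infnorm_lift_trans_le[OF mdp] state_max_diff_abs_le)
  also have "\<dots> \<le> disc M * (disc M ^ l * infnorm (Qiter M Q0 j - Qstar M))"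
    using Suc disc_bounds[OF mdp] by (intro mult_left_mono) auto
  finally show ?case by (simp add: mult.assoc)
qed simp

text \<open>The factor in front is the norm equivalence constant; it depends neither on
  \<open>Q0\<close> nor on the starting index \<open>j\<close>, so \<open>j\<close> may be taken to
  be \<open>K_id\<close>.\<close>

lemma norm_Qiter_bound:
  "norm (Qiter M Q0 (j + l) - Qstar M)
    \<le> sqrt DIM(real^('s \<times> 'a)) * disc M ^ l * norm (Qiter M Q0 j - Qstar M)"
proof -
  have "norm (Qiter M Q0 (j + l) - Qstar M)
    \<le> sqrt DIM(real^('s \<times> 'a)) * infnorm (Qiter M Q0 (j + l) - Qstar M)"
    by (rule norm_le_infnorm)
  also have "\<dots> \<le> sqrt DIM(real^('s \<times> 'a)) * (disc M ^ l * norm (Qiter M Q0 j - Qstar M))"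
    using disc_bounds[OF mdp]
    by (intro mult_left_mono order_trans[OF infnorm_Qiter_bound] infnorm_le_norm) auto
  finally show ?thesis by (simp only: mult.assoc)
qed

end

theorem theorem2:
  fixes M :: "('s::finite, 'a::finite) mdp"
  assumes "is_mdp M"
    and "Ssep M \<noteq> {}"
  shows "rho_star M \<le> rho_bar M \<and> rho_bar M \<le> disc M \<and>
    \<comment> \<open>1\<close>
    (\<forall>tb. tie_breaking tb \<longrightarrow> X1 M \<subset> Xstar M tb) \<and>
    (\<forall>\<epsilon>>0. rho_bar M + \<epsilon> < 1 \<longrightarrow>
      (\<exists>c>0. \<forall>Q0 k.
         infdist (Qiter M Q0 k) (X1 M) \<le> c * (rho_bar M + \<epsilon>) ^ k * infdist Q0 (X1 M) \<and>
         (\<forall>tb. tie_breaking tb \<longrightarrow>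
           infdist (Qiter M Q0 k) (Xstar M tb) \<le> c * (rho_bar M + \<epsilon>) ^ k * infdist Q0 (X1 M)))) \<and>
    \<comment> \<open>2\<close>
    (\<forall>\<epsilon>0 c0 Q0. id_consts M \<epsilon>0 c0 \<longrightarrow>
      (\<forall>k\<ge>K_id M \<epsilon>0 c0 Q0. \<exists>\<pi>\<in>Thetastar M.
         Qiter M Q0 (Suc k) - Qstar M = A_mat M \<pi> *v (Qiter M Q0 k - Qstar M))) \<and>
    \<comment> \<open>3\<close>
    (\<forall>\<epsilon>>0. rho_star M + \<epsilon> < 1 \<longrightarrow>
      (\<exists>C>0. \<forall>\<epsilon>0 c0 Q0. id_consts M \<epsilon>0 c0 \<longrightarrow>
        (\<forall>l. norm (zvec M Q0 (K_id M \<epsilon>0 c0 Q0 + l))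
             \<le> C * (rho_star M + \<epsilon>) ^ l * norm (zvec M Q0 (K_id M \<epsilon>0 c0 Q0))))) \<and>
    \<comment> \<open>4\<close>
    (rho_star M < disc M \<longrightarrow>
      (\<exists>\<epsilon>>0. rho_star M + \<epsilon> < disc M) \<and>
      (\<forall>\<epsilon>>0. rho_star M + \<epsilon> < disc M \<longrightarrow>
        (\<exists>D>0. \<forall>\<epsilon>0 c0 Q0. id_consts M \<epsilon>0 c0 \<longrightarrow>
          (\<forall>l. norm (Qiter M Q0 (K_id M \<epsilon>0 c0 Q0 + l) - Qstar M)
               \<le> D * disc M ^ l * norm (Qiter M Q0 (K_id M \<epsilon>0 c0 Q0) - Qstar M)))))"
proof -
  note mdp = assms(1) and sep = assms(2)
  have rate: "\<exists>c>0. \<forall>Q0 k.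
      infdist (Qiter M Q0 k) (X1 M) \<le> c * (rho_bar M + \<epsilon>) ^ k * infdist Q0 (X1 M) \<and>
      (\<forall>tb. tie_breaking tb \<longrightarrow>
        infdist (Qiter M Q0 k) (Xstar M tb) \<le> c * (rho_bar M + \<epsilon>) ^ k * infdist Q0 (X1 M))"
    if "\<epsilon> > 0" for \<epsilon>
  proof -
    obtain C where C: "C > 0"
      "\<And>Q0 k. norm (zvec M Q0 k) \<le> C * (rho_bar M + \<epsilon>) ^ k * norm (zvec M Q0 0)"
      using zvec_bound[OF mdp, of "rho_bar M + \<epsilon>"] \<open>\<epsilon> > 0\<close> by auto
    have X1: "infdist (Qiter M Q0 k) (X1 M) \<le> C * (rho_bar M + \<epsilon>) ^ k * infdist Q0 (X1 M)" for Q0 k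
    proof -
      have "infdist Q0 (X1 M) = norm (zvec M Q0 0)" using infdist_Qiter[of M Q0 0] by (simp add: Qiter_def)
      then show ?thesis by (simp only: infdist_Qiter C(2))
    qed
    \<comment> \<open>Distance decreases when the target set grows, so the same constant serves for
      \<open>Xstar M tb\<close>.\<close>
    have "infdist Q (Xstar M tb) \<le> infdist Q (X1 M)" if "tie_breaking tb" for Q tb
      using X1_psubset_Xstar[OF sep that] by (intro infdist_mono) (auto simp: X1_eq)
    then show ?thesis using C(1) X1 order_trans by blast
  qed
  have "\<exists>\<pi>\<in>Thetastar M. Qiter M Q0 (Suc k) - Qstar M = A_mat M \<pi> *v (Qiter M Q0 k - Qstar M)"
    if "id_consts M \<epsilon>0 c0" "K_id M \<epsilon>0 c0 Q0 \<le> k" for \<epsilon>0 c0 Q0 k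
    unfolding Qiter_Suc by (rule identified_step[OF mdp infdist_after_K_id[OF mdp sep that]])
  moreover have "\<exists>C>0. \<forall>\<epsilon>0 c0 Q0. id_consts M \<epsilon>0 c0 \<longrightarrow>
      (\<forall>l. norm (zvec M Q0 (K_id M \<epsilon>0 c0 Q0 + l))
         \<le> C * (rho_star M + \<epsilon>) ^ l * norm (zvec M Q0 (K_id M \<epsilon>0 c0 Q0)))" if "\<epsilon> > 0" for \<epsilon>
    using that by (intro zvec_bound_after_K_id mdp sep) simp
  moreover have "\<exists>D>0. \<forall>\<epsilon>0 c0 Q0. id_consts M \<epsilon>0 c0 \<longrightarrow>
      (\<forall>l. norm (Qiter M Q0 (K_id M \<epsilon>0 c0 Q0 + l) - Qstar M)
         \<le> D * disc M ^ l * norm (Qiter M Q0 (K_id M \<epsilon>0 c0 Q0) - Qstar M))"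
    using norm_Qiter_bound[OF mdp] by (intro exI[of _ "sqrt DIM(real^('s \<times> 'a))"]) auto
  moreover have "\<exists>\<epsilon>>0. rho_star M + \<epsilon> < disc M" if "rho_star M < disc M"
    using that by (intro exI[of _ "(disc M - rho_star M) / 2"]) (auto simp: field_simps)
  ultimately show ?thesis
    using rho_star_le_rho_bar rho_bar_le_disc[OF mdp] X1_psubset_Xstar[OF sep] rate
    by (intro conjI allI impI) blast+
qed

end
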